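(* Let $d$ be a $\mathbb{D}_{\mathrm{nd}}$-generic real over $V$ and let $y\in\omega^\omega\cap V[d]$ be dominating. Then there are $z_0,z_1\in V\cap\omega^{\nearrow\omega}$ such that $z_0\circ d\circ z_1\leq^* y$.
   Context: $\omega^{\nearrow\omega}$ denotes the set of monotonically nondecreasing functions in $\omega^\omega$ that tend to infinity. $x\leq^* y$ means $x(n)\leq y(n)$ for all but finitely many $n$; $y$ is dominating over $V$ if $f\leq^* y$ for all $f\in V\cap\omega^\omega$. Nondecreasing Hechler forcing $\mathbb{D}_{\mathrm{nd}}$: conditions are pairs $\langle s,f\rangle$ with $s\in\omega^{<\omega}$ nondecreasing and $f\in\omega^\omega$, ordered by $\langle s',f'\rangle\leq\langle s,f\rangle$ iff $s\subseteq s'$, $f(n)\leq f'(n)$ for all $n$, and $f(n)\leq s'(n)$ for all $n\in|s'|\setminus|s|$. The generic real is the union of the first coordinates of conditions in the generic filter. *)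

theory Defs
  imports Complex_Main "HOL-Library.Countable_Set"
begin

section \<open>Forcing over the universe\<close>

text \<open>
  The ground model \<open>V\<close> is the universe of HOL, so that \<open>V \<inter> \<omega>\<^sup>\<omega>\<close> is the type \<^typ>\<open>nat \<Rightarrow> nat\<close>.
  A forcing notion is a type of class \<^class>\<open>order_top\<close>; \<open>q \<le> p\<close> means that \<open>q\<close> is stronger than \<open>p\<close>.
  ``\<open>\<phi>\<close> holds in \<open>V[G]\<close>, where \<open>G\<close> is generic over \<open>V\<close>'' means that \<open>\<phi>\<close> is forced by every
  condition, for the usual forcing relation on names.
\<close>

subsection \<open>Names\<close>

text \<open>
  A name is a set of pairs of a name and a condition.  A datatype cannot recurse through arbitrary
  sets, so the set is given as the range of a partial function on an index type \<open>'i\<close>, which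
  bounds the hereditary size of the names; statements are meant to be polymorphic in it, so
  that names of every size are covered.
\<close>

datatype ('i, 'p) name = Name (name_fun: "'i \<Rightarrow> (('i, 'p) name \<times> 'p) option")

definition pairs :: "('i, 'p) name \<Rightarrow> (('i, 'p) name \<times> 'p) set" where
  "pairs \<tau> = ran (name_fun \<tau>)"

lemma wf_pairs: "wf {(\<sigma> :: ('i, 'p) name, \<tau>). \<exists>s. (\<sigma>, s) \<in> pairs \<tau>}"
proof (rule wfUNIVI)
  fix P :: "('i, 'p) name \<Rightarrow> bool" and x :: "('i, 'p) name"
  assume *: "\<forall>\<tau>. (\<forall>\<sigma>. (\<sigma>, \<tau>) \<in> {(\<sigma>, \<tau>). \<exists>s. (\<sigma>, s) \<in> pairs \<tau>} \<longrightarrow> P \<sigma>) \<longrightarrow> P \<tau>"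
  show "P x"
  proof (induction x)
    case (Name F)
    have "P \<sigma>" if mem: "(\<sigma>, s) \<in> pairs (Name F)" for \<sigma> s
    proof -
      obtain i where i: "F i = Some (\<sigma>, s)"
        using mem by (auto simp: pairs_def ran_def)
      show ?thesis
        by (rule Name.IH[of "F i" "(\<sigma>, s)"]) (auto simp: i intro: rev_image_eqI[of i])
    qed
    then show ?case
      using * by blast
  qed
qed

text \<open>The name consisting of the given pairs; meaningful if there are at most \<open>|'i|\<close> of them.\<close>

definition mk_name :: "(('i, 'p) name \<times> 'p) set \<Rightarrow> ('i, 'p) name" where
  "mk_name S = (SOME \<tau>. pairs \<tau> = S)"

lemma pairs_mk_name:
  fixes S :: "(('i, 'p) name \<times> 'p) set" and g :: "'a \<Rightarrow> ('i, 'p) name \<times> 'p" and h :: "'a \<Rightarrow> 'i"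
  assumes "S = g ` T" and "inj_on h T"
  shows "pairs (mk_name S) = S"
proof -
  define F where "F i = (if i \<in> h ` T then Some (g (inv_into T h i)) else None)" for i
  have F: "F (h t) = Some (g t)" if "t \<in> T" for t
    using assms(2) that by (simp add: F_def)
  have "ran F = g ` T"
  proof
    show "ran F \<subseteq> g ` T"
    proof
      fix x assume "x \<in> ran F"
      then obtain i where i: "F i = Some x"
        by (auto simp: ran_def)
      then obtain t where "t \<in> T" "i = h t"
        by (auto simp: F_def split: if_splits)
      then show "x \<in> g ` T"
        using i F[of t] by auto
    qed
    show "g ` T \<subseteq> ran F"
      by (intro image_subsetI ranI) (rule F)
  qed
  then have "pairs (Name F) = S"
    by (simp add: pairs_def assms(1))
  then show ?thesis
    unfolding mk_name_def by (rule someI)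
qed

subsection \<open>The forcing relation\<close>

text \<open>A formula of the forcing language is identified with the set of conditions that force it.\<close>

type_synonym 'p fprop = "'p \<Rightarrow> bool"

function feq :: "('i, 'p::order_top) name \<Rightarrow> ('i, 'p) name \<Rightarrow> 'p fprop" where
  "feq \<sigma> \<tau> p \<longleftrightarrow>
     (\<forall>(\<pi>, s)\<in>pairs \<sigma>. \<forall>q\<le>p. q \<le> s \<longrightarrow> (\<exists>r\<le>q. \<exists>(\<pi>', s')\<in>pairs \<tau>. r \<le> s' \<and> feq \<pi> \<pi>' r)) \<and>
     (\<forall>(\<pi>', s')\<in>pairs \<tau>. \<forall>q\<le>p. q \<le> s' \<longrightarrow> (\<exists>r\<le>q. \<exists>(\<pi>, s)\<in>pairs \<sigma>. r \<le> s \<and> feq \<pi> \<pi>' r))"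
  by pat_completeness auto
termination
  by (relation "inv_image {(\<sigma>, \<tau>). \<exists>s. (\<sigma>, s) \<in> pairs \<tau>} fst") (auto intro: wf_pairs)

declare feq.simps [simp del]

definition fmem :: "('i, 'p::order_top) name \<Rightarrow> ('i, 'p) name \<Rightarrow> 'p fprop" where
  "fmem \<sigma> \<tau> p \<longleftrightarrow> (\<forall>q\<le>p. \<exists>r\<le>q. \<exists>(\<pi>, s)\<in>pairs \<tau>. r \<le> s \<and> feq \<sigma> \<pi> r)"

notation feq (infix "\<^bold>=" 50)
notation fmem (infix "\<^bold>\<in>" 50)

definition fnot :: "'p::order_top fprop \<Rightarrow> 'p fprop" ("\<^bold>\<not> _" [40] 40) where
  "(\<^bold>\<not> \<phi>) p \<longleftrightarrow> (\<forall>q\<le>p. \<not> \<phi> q)"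

definition fconj :: "'p fprop \<Rightarrow> 'p fprop \<Rightarrow> 'p fprop" (infixr "\<^bold>\<and>" 35) where
  "(\<phi> \<^bold>\<and> \<psi>) p \<longleftrightarrow> \<phi> p \<and> \<psi> p"

definition fall :: "(('i, 'p) name \<Rightarrow> 'p fprop) \<Rightarrow> 'p fprop" (binder "\<^bold>\<forall>" 10) where
  "(\<^bold>\<forall>x. \<phi> x) p \<longleftrightarrow> (\<forall>x. \<phi> x p)"

definition fdisj :: "'p::order_top fprop \<Rightarrow> 'p fprop \<Rightarrow> 'p fprop" (infixr "\<^bold>\<or>" 30) where
  "(\<phi> \<^bold>\<or> \<psi>) = (\<^bold>\<not> (\<^bold>\<not> \<phi> \<^bold>\<and> \<^bold>\<not> \<psi>))"

definition fimp :: "'p::order_top fprop \<Rightarrow> 'p fprop \<Rightarrow> 'p fprop" (infixr "\<^bold>\<longrightarrow>" 25) where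
  "(\<phi> \<^bold>\<longrightarrow> \<psi>) = (\<^bold>\<not> (\<phi> \<^bold>\<and> \<^bold>\<not> \<psi>))"

definition fex :: "(('i, 'p) name \<Rightarrow> 'p::order_top fprop) \<Rightarrow> 'p fprop" (binder "\<^bold>\<exists>" 10) where
  "(\<^bold>\<exists>x. \<phi> x) = (\<^bold>\<not> (\<^bold>\<forall>x. \<^bold>\<not> \<phi> x))"

definition fball :: "('i, 'p) name \<Rightarrow> (('i, 'p) name \<Rightarrow> 'p::order_top fprop) \<Rightarrow> 'p fprop" where
  "fball \<tau> \<phi> = (\<^bold>\<forall>x. x \<^bold>\<in> \<tau> \<^bold>\<longrightarrow> \<phi> x)"

definition fbex :: "('i, 'p) name \<Rightarrow> (('i, 'p) name \<Rightarrow> 'p::order_top fprop) \<Rightarrow> 'p fprop" where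
  "fbex \<tau> \<phi> = (\<^bold>\<exists>x. x \<^bold>\<in> \<tau> \<^bold>\<and> \<phi> x)"

syntax
  "_fball" :: "pttrn \<Rightarrow> 'a \<Rightarrow> 'b \<Rightarrow> 'b"  ("(3\<^bold>\<forall>_\<^bold>\<in>_./ _)" [0, 0, 10] 10)
  "_fbex" :: "pttrn \<Rightarrow> 'a \<Rightarrow> 'b \<Rightarrow> 'b"  ("(3\<^bold>\<exists>_\<^bold>\<in>_./ _)" [0, 0, 10] 10)
translations
  "\<^bold>\<forall>x\<^bold>\<in>t. \<phi>" \<rightleftharpoons> "CONST fball t (\<lambda>x. \<phi>)"
  "\<^bold>\<exists>x\<^bold>\<in>t. \<phi>" \<rightleftharpoons> "CONST fbex t (\<lambda>x. \<phi>)"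

definition forced :: "'p fprop \<Rightarrow> bool" ("\<tturnstile> _" [5] 5) where
  "(\<tturnstile> \<phi>) \<longleftrightarrow> (\<forall>p. \<phi> p)"

text \<open>The recursion for equality is the textbook one: mutual forced inclusion.\<close>

lemma feq_sym: "(\<sigma> \<^bold>= \<tau>) p \<longleftrightarrow> (\<tau> \<^bold>= \<sigma>) p"
proof (induction \<sigma> arbitrary: \<tau> p rule: wf_induct_rule[OF wf_pairs])
  case (1 \<sigma>)
  have IH: "(\<pi> \<^bold>= \<pi>') r \<longleftrightarrow> (\<pi>' \<^bold>= \<pi>) r" if "(\<pi>, s) \<in> pairs \<sigma>" for \<pi> \<pi>' s r
    using 1[of \<pi>] that by blast
  have ex: "(\<exists>(\<pi>, s)\<in>pairs \<sigma>. r \<le> s \<and> (\<pi> \<^bold>= \<pi>') r) \<longleftrightarrow> (\<exists>(\<pi>, s)\<in>pairs \<sigma>. r \<le> s \<and> (\<pi>' \<^bold>= \<pi>) r)"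
    for r \<pi>'
    using IH by blast
  have all: "(\<forall>(\<pi>, s)\<in>pairs \<sigma>. \<forall>q\<le>p. q \<le> s \<longrightarrow> (\<exists>r\<le>q. \<exists>(\<pi>', s')\<in>pairs \<tau>. r \<le> s' \<and> (\<pi> \<^bold>= \<pi>') r)) \<longleftrightarrow>
      (\<forall>(\<pi>, s)\<in>pairs \<sigma>. \<forall>q\<le>p. q \<le> s \<longrightarrow> (\<exists>r\<le>q. \<exists>(\<pi>', s')\<in>pairs \<tau>. r \<le> s' \<and> (\<pi>' \<^bold>= \<pi>) r))"
  proof (intro ball_cong refl, clarify)
    fix \<pi> s assume "(\<pi>, s) \<in> pairs \<sigma>"
    then have "feq \<pi> = (\<lambda>\<pi>' r. feq \<pi>' \<pi> r)"
      by (intro ext) (rule IH)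
    then show "(\<forall>q\<le>p. q \<le> s \<longrightarrow> (\<exists>r\<le>q. \<exists>(\<pi>', s')\<in>pairs \<tau>. r \<le> s' \<and> (\<pi> \<^bold>= \<pi>') r)) \<longleftrightarrow>
        (\<forall>q\<le>p. q \<le> s \<longrightarrow> (\<exists>r\<le>q. \<exists>(\<pi>', s')\<in>pairs \<tau>. r \<le> s' \<and> (\<pi>' \<^bold>= \<pi>) r))"
      by (subst \<open>feq \<pi> = _\<close>) (rule refl)
  qed
  show ?case
    unfolding feq.simps[of \<sigma> \<tau>] feq.simps[of \<tau> \<sigma>] ex all by (rule conj_commute)
qed

lemma feq_iff:
  "(\<sigma> \<^bold>= \<tau>) p \<longleftrightarrow>
     (\<forall>(\<pi>, s)\<in>pairs \<sigma>. \<forall>q\<le>p. q \<le> s \<longrightarrow> (\<pi> \<^bold>\<in> \<tau>) q) \<and>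
     (\<forall>(\<pi>, s)\<in>pairs \<tau>. \<forall>q\<le>p. q \<le> s \<longrightarrow> (\<pi> \<^bold>\<in> \<sigma>) q)"
proof -
  have dense: "(\<forall>q\<le>p. q \<le> s \<longrightarrow> (\<forall>q'\<le>q. P q')) \<longleftrightarrow> (\<forall>q\<le>p. q \<le> s \<longrightarrow> P q)"
    for s and P :: "'b \<Rightarrow> bool"
    by (meson order.refl order.trans)
  have mem: "(\<pi> \<^bold>\<in> \<sigma>) q \<longleftrightarrow> (\<forall>q'\<le>q. \<exists>r\<le>q'. \<exists>(\<pi>', s)\<in>pairs \<sigma>. r \<le> s \<and> (\<pi>' \<^bold>= \<pi>) r)" for \<pi> q
  proof -
    have sym: "feq \<pi> = (\<lambda>\<pi>' r. feq \<pi>' \<pi> r)"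
      by (intro ext) (rule feq_sym)
    show ?thesis
      unfolding fmem_def by (subst sym) (rule refl)
  qed
  show ?thesis
    unfolding feq.simps[of \<sigma> \<tau>] mem dense unfolding fmem_def dense by (rule refl)
qed

section \<open>Natural numbers and reals in the forcing language\<close>

primrec check_nat :: "nat \<Rightarrow> ('i, 'p::order_top) name" where
  "check_nat 0 = mk_name {}"
| "check_nat (Suc n) = mk_name (insert (check_nat n, top) (pairs (check_nat n)))"

definition omega :: "('i, 'p::order_top) name" ("\<^bold>\<omega>") where
  "\<^bold>\<omega> = mk_name (range (\<lambda>n. (check_nat n, top)))"

definition upair :: "('i, 'p::order_top) name \<Rightarrow> ('i, 'p) name \<Rightarrow> ('i, 'p) name" where
  "upair \<sigma> \<tau> = mk_name {(\<sigma>, top), (\<tau>, top)}"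

definition opair :: "('i, 'p::order_top) name \<Rightarrow> ('i, 'p) name \<Rightarrow> ('i, 'p) name" where
  "opair \<sigma> \<tau> = upair (upair \<sigma> \<sigma>) (upair \<sigma> \<tau>)"

definition check_real :: "(nat \<Rightarrow> nat) \<Rightarrow> ('i, 'p::order_top) name" where
  "check_real f = mk_name (range (\<lambda>n. (opair (check_nat n) (check_nat (f n)), top)))"

definition check_reals :: "(nat \<Rightarrow> nat) set \<Rightarrow> ('i, 'p::order_top) name" where
  "check_reals A = mk_name ((\<lambda>f. (check_real f, top)) ` A)"

text \<open>The order on natural numbers (von Neumann numerals).\<close>

definition nat_le :: "('i, 'p::order_top) name \<Rightarrow> ('i, 'p) name \<Rightarrow> 'p fprop" (infix "\<^bold>\<le>" 50) where
  "(m \<^bold>\<le> n) = (m \<^bold>\<in> n \<^bold>\<or> m \<^bold>= n)"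

text \<open>\<open>x \<in> \<omega>\<^sup>\<omega>\<close>\<close>

definition is_real :: "('i, 'p::order_top) name \<Rightarrow> 'p fprop" where
  "is_real x =
     ((\<^bold>\<forall>u\<^bold>\<in>x. \<^bold>\<exists>n\<^bold>\<in>\<^bold>\<omega>. \<^bold>\<exists>m\<^bold>\<in>\<^bold>\<omega>. u \<^bold>= opair n m) \<^bold>\<and>
      (\<^bold>\<forall>n\<^bold>\<in>\<^bold>\<omega>. \<^bold>\<exists>m\<^bold>\<in>\<^bold>\<omega>. opair n m \<^bold>\<in> x) \<^bold>\<and>
      (\<^bold>\<forall>n\<^bold>\<in>\<^bold>\<omega>. \<^bold>\<forall>m\<^bold>\<in>\<^bold>\<omega>. \<^bold>\<forall>m'\<^bold>\<in>\<^bold>\<omega>. opair n m \<^bold>\<in> x \<^bold>\<and> opair n m' \<^bold>\<in> x \<^bold>\<longrightarrow> m \<^bold>= m'))"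

text \<open>Functions are handled through their graphs, \<open>graph x n m\<close> being the formula \<open>x(n) = m\<close>.\<close>

type_synonym ('i, 'p) fgraph = "('i, 'p) name \<Rightarrow> ('i, 'p) name \<Rightarrow> 'p fprop"

definition graph :: "('i, 'p::order_top) name \<Rightarrow> ('i, 'p) fgraph" where
  "graph x n m = (opair n m \<^bold>\<in> x)"

definition fcomp :: "('i, 'p::order_top) fgraph \<Rightarrow> ('i, 'p) fgraph \<Rightarrow> ('i, 'p) fgraph"
    (infixl "\<^bold>\<circ>" 55) where
  "(F \<^bold>\<circ> G) n m = (\<^bold>\<exists>k\<^bold>\<in>\<^bold>\<omega>. G n k \<^bold>\<and> F k m)"

definition le_star :: "('i, 'p::order_top) fgraph \<Rightarrow> ('i, 'p) fgraph \<Rightarrow> 'p fprop"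
    (infix "\<^bold>\<le>\<^sup>*" 50) where
  "(F \<^bold>\<le>\<^sup>* G) =
     (\<^bold>\<exists>k\<^bold>\<in>\<^bold>\<omega>. \<^bold>\<forall>n\<^bold>\<in>\<^bold>\<omega>. k \<^bold>\<le> n \<^bold>\<longrightarrow>
        (\<^bold>\<forall>a\<^bold>\<in>\<^bold>\<omega>. \<^bold>\<forall>b\<^bold>\<in>\<^bold>\<omega>. F n a \<^bold>\<and> G n b \<^bold>\<longrightarrow> a \<^bold>\<le> b))"

text \<open>\<open>y\<close> is dominating over \<open>V\<close>; \<open>V \<inter> \<omega>\<^sup>\<omega>\<close> has the name \<open>check_reals UNIV\<close>.\<close>

definition dominating :: "('i, 'p::order_top) name \<Rightarrow> 'p fprop" where
  "dominating y = (\<^bold>\<forall>f\<^bold>\<in>check_reals UNIV. graph f \<^bold>\<le>\<^sup>* graph y)"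

definition nondec_unbounded :: "(nat \<Rightarrow> nat) set" where
  "nondec_unbounded = {z. mono z \<and> filterlim z at_top sequentially}"

section \<open>Nondecreasing Hechler forcing\<close>

typedef dnd = "{(s :: nat list, f :: nat \<Rightarrow> nat). sorted s}"
  by (rule exI[of _ "([], \<lambda>_. 0)"]) simp

definition stem :: "dnd \<Rightarrow> nat list" where
  "stem p = fst (Rep_dnd p)"

definition side :: "dnd \<Rightarrow> nat \<Rightarrow> nat" where
  "side p = snd (Rep_dnd p)"

lemma dnd_eqI: "stem p = stem q \<Longrightarrow> side p = side q \<Longrightarrow> p = q"
  by (simp add: stem_def side_def prod_eq_iff flip: Rep_dnd_inject)

instantiation dnd :: order_top
begin

definition less_eq_dnd :: "dnd \<Rightarrow> dnd \<Rightarrow> bool" where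
  "p' \<le> p \<longleftrightarrow>
     (\<exists>t. stem p' = stem p @ t) \<and>
     (\<forall>n. side p n \<le> side p' n) \<and>
     (\<forall>n. length (stem p) \<le> n \<and> n < length (stem p') \<longrightarrow> side p n \<le> stem p' ! n)"

definition less_dnd :: "dnd \<Rightarrow> dnd \<Rightarrow> bool" where
  "(p' :: dnd) < p \<longleftrightarrow> p' \<le> p \<and> \<not> p \<le> p'"

definition top_dnd :: dnd where
  "top_dnd = Abs_dnd ([], \<lambda>_. 0)"

instance
proof
  fix p q r :: dnd
  show "p < q \<longleftrightarrow> p \<le> q \<and> \<not> q \<le> p"
    by (rule less_dnd_def)
  show "p \<le> p"
    by (simp add: less_eq_dnd_def)
  show "p \<le> r" if pq: "p \<le> q" and qr: "q \<le> r"
    unfolding less_eq_dnd_def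
  proof (intro conjI allI impI)
    obtain t u where t: "stem p = stem q @ t" and u: "stem q = stem r @ u"
      using pq qr unfolding less_eq_dnd_def by blast
    show "\<exists>t. stem p = stem r @ t"
      using t u by simp
    show "side r n \<le> side p n" for n
      using pq qr unfolding less_eq_dnd_def by (meson order.trans)
    show "side r n \<le> stem p ! n" if n: "length (stem r) \<le> n \<and> n < length (stem p)" for n
    proof (cases "n < length (stem q)")
      case True
      then have "stem p ! n = stem q ! n"
        by (simp add: t nth_append)
      then show ?thesis
        using True n qr unfolding less_eq_dnd_def by simp
    next
      case False
      then have "side q n \<le> stem p ! n"
        using n pq unfolding less_eq_dnd_def by simp
      moreover have "side r n \<le> side q n"
        using qr unfolding less_eq_dnd_def by blast
      ultimately show ?thesis
        by simp
    qed
  qed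
  show "p = q" if "p \<le> q" "q \<le> p"
    using that unfolding less_eq_dnd_def by (intro dnd_eqI ext) (auto intro: order.antisym)
  show "p \<le> top"
    by (simp add: less_eq_dnd_def top_dnd_def stem_def side_def Abs_dnd_inverse)
qed

end

text \<open>
  The index type is at least of the size of the continuum, so that the names \<open>check_reals A\<close> and
  \<open>generic_real\<close> below exist.
\<close>

type_synonym 'i dnd_name = "((nat \<Rightarrow> nat) + 'i, dnd) name"

text \<open>
  The name for the union of the first coordinates of the conditions in the generic filter:
  \<open>p\<close> puts the pair \<open>(n, s(n))\<close> into it for \<open>n < |s|\<close>, \<open>s\<close> being the first coordinate of \<open>p\<close>.
\<close>

definition generic_real :: "'i dnd_name" ("\<^bold>d") where
  "\<^bold>d = mk_name {(opair (check_nat n) (check_nat (stem p ! n)), p) | n p. n < length (stem p)}"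

text \<open>The sets of pairs passed to \<^const>\<open>mk_name\<close> above are indeed small enough.\<close>

lemma pairs_mk_name_countable:
  fixes S :: "('i dnd_name \<times> dnd) set"
  assumes "countable S"
  shows "pairs (mk_name S) = S"
proof -
  obtain h :: "'i dnd_name \<times> dnd \<Rightarrow> nat" where h: "inj_on h S"
    using assms unfolding countable_def by blast
  have "inj_on (\<lambda>x. Inl (\<lambda>_. h x) :: (nat \<Rightarrow> nat) + 'i) S"
    by (intro inj_onI) (auto dest: fun_cong inj_onD[OF h])
  then show ?thesis
    by (intro pairs_mk_name[where g = id]) auto
qed

lemma pairs_check_reals:
  "pairs (check_reals A :: 'i dnd_name) = (\<lambda>f. (check_real f, top)) ` A"
  unfolding check_reals_def
  by (rule pairs_mk_name[where h = Inl, OF refl]) (simp add: inj_on_def)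

lemma pairs_generic_real:
  "pairs (\<^bold>d :: 'i dnd_name) =
     {(opair (check_nat n) (check_nat (stem p ! n)), p) | n p. n < length (stem p)}"
proof -
  define h :: "nat \<times> dnd \<Rightarrow> (nat \<Rightarrow> nat) + 'i" where
    "h = (\<lambda>(n, p). Inl (case_nat n (case_nat (to_nat (stem p)) (side p))))"
  have "inj h"
  proof (rule injI)
    fix x y assume xy: "h x = h y"
    obtain n p m q where [simp]: "x = (n, p)" "y = (m, q)"
      by (cases x, cases y) blast
    have *: "case_nat n (case_nat (to_nat (stem p)) (side p)) k =
        case_nat m (case_nat (to_nat (stem q)) (side q)) k" for k
      using xy by (simp add: h_def)
    have "n = m" "stem p = stem q"
      using *[of 0] *[of 1] by simp_all
    moreover have "side p k = side q k" for k
      using *[of "Suc (Suc k)"] by simp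
    ultimately show "x = y"
      by (auto intro: dnd_eqI)
  qed
  then show ?thesis
    unfolding generic_real_def
    by (intro pairs_mk_name[where h = h and T = "{(n, p). n < length (stem p)}"
          and g = "\<lambda>(n, p). (opair (check_nat n) (check_nat (stem p ! n)), p)"])
       (auto intro: inj_on_subset)
qed

end

theory Submission
  imports Defs
begin

text \<open>
  Call a stem \<open>t\<close> \<^emph>\<open>unbounded at \<open>n\<close>\<close> if for every \<open>m\<close> some condition with stem \<open>t\<close> forces
  \<open>m < y(n)\<close>; otherwise no condition with stem \<open>t\<close> can push \<open>y(n)\<close> above a fixed value.  Let \<open>h \<in> V\<close>
  exceed, at \<open>n\<close>, these fixed values for finitely many representative stems, and let
  \<open>q = \<langle>t\<^sub>0, f\<^sub>0\<rangle>\<close> decide from where on \<open>h \<le> y\<close>.  Induction on \<open>l\<close> shows that, for almost all \<open>n\<close>, every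
  extension of \<open>t\<^sub>0\<close> by \<open>l\<close> values allowed by \<open>q\<close> is unbounded at \<open>n\<close>: if the first new value is
  small, use the induction hypothesis; if it is large then, stems being nondecreasing, all new values
  are large, and a representative stem is itself allowed by \<open>q\<close>, which contradicts \<open>h(n) \<le> y(n)\<close>.
  Hence there is \<open>z\<^sub>1\<close> such that all allowed stems of length at most \<open>z\<^sub>1(n)\<close> are unbounded at \<open>n\<close>.
  Let \<open>f\<^sub>1\<close> eventually dominate the countably many side functions that witness unboundedness.
  If \<open>d(z\<^sub>1(n))\<close> is above the last of \<open>m + 1\<close> rapidly increasing thresholds with \<open>n < m\<close>,
  the pigeonhole principle gives a gap of \<open>d\<close> between two consecutive thresholds; the part of \<open>d\<close>
  below the gap is one of finitely many stems, and the values above the gap exceed the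
  witness for \<open>m < y(n)\<close> wherever \<open>f\<^sub>1\<close> does not.  The case \<open>m \<le> n\<close> is covered by \<open>n \<le> h(n)\<close>.
\<close>

section \<open>Combinatorics of the forcing notion\<close>

definition cond :: "nat list \<Rightarrow> (nat \<Rightarrow> nat) \<Rightarrow> dnd" where
  "cond s f = Abs_dnd (s, f)"

lemma stem_cond [simp]: "sorted s \<Longrightarrow> stem (cond s f) = s"
  and side_cond [simp]: "sorted s \<Longrightarrow> side (cond s f) = f"
  by (simp_all add: cond_def stem_def side_def Abs_dnd_inverse)

lemma sorted_stem [simp]: "sorted (stem p)"
  using Rep_dnd[of p] by (auto simp: stem_def)

lemma le_condI:
  assumes "sorted s" "stem p = s @ u" "\<And>i. f i \<le> side p i"
    and "\<And>i. length s \<le> i \<Longrightarrow> i < length (stem p) \<Longrightarrow> f i \<le> stem p ! i"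
  shows "p \<le> cond s f"
  using assms by (auto simp: less_eq_dnd_def)

text \<open>\<open>z v\<close> is the largest \<open>m \<le> v\<close> that is 0 or has
  \<open>a m \<le> v\<close>. The bound by \<open>v\<close> leaves finitely many candidates whatever
  the growth of \<open>a\<close>, and no candidate is lost when \<open>v\<close> increases.\<close>

lemma slow_inverse:
  fixes a :: "nat \<Rightarrow> nat"
  obtains z where "z \<in> nondec_unbounded" "\<And>v. z v = 0 \<or> a (z v) \<le> v"
proof -
  define S where "S v = {m. m \<le> v \<and> (m = 0 \<or> a m \<le> v)}" for v
  define z where "z v = Max (S v)" for v
  have fin: "finite (S v)" for v
    by (rule finite_subset[of _ "{..v}"]) (auto simp: S_def)
  have ne: "S v \<noteq> {}" for v
    by (auto simp: S_def)
  have "mono z"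
    unfolding z_def by (intro monoI Max_mono fin ne) (auto simp: S_def)
  moreover have "filterlim z at_top sequentially"
    unfolding filterlim_at_top
  proof
    fix m
    have "m \<le> z v" if "max m (a m) \<le> v" for v
      unfolding z_def using that by (intro Max_ge fin) (auto simp: S_def)
    then show "\<forall>\<^sub>F v in sequentially. m \<le> z v"
      by (rule eventually_sequentiallyI)
  qed
  moreover have "z v = 0 \<or> a (z v) \<le> v" for v
    using Max_in[OF fin ne, of v] by (auto simp: z_def S_def)
  ultimately show thesis
    by (intro that[of z]) (auto simp: nondec_unbounded_def)
qed

text \<open>Descend from \<open>k\<close>: either the inequality also holds at the preceding index,
  or the entry there, and with it all earlier ones, lies below the threshold, which makes a gap. At
  index 0 no earlier entries remain.\<close>

lemma sorted_gap:
  fixes w :: "nat list" and A :: "nat \<Rightarrow> nat"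
  assumes "sorted w" "k < length w" "A (Suc k) \<le> w ! k"
  shows "\<exists>i\<le>k. \<exists>j\<le>k. (\<forall>x\<in>set (take j w). x < A i) \<and> A (Suc i) \<le> w ! j"
  using assms(2,3)
proof (induction k)
  case 0
  then show ?case by auto
next
  case (Suc k)
  show ?case
  proof (cases "A (Suc k) \<le> w ! k")
    case True
    then show ?thesis
      using Suc.IH Suc.prems by (metis Suc_lessD le_SucI)
  next
    case False
    have "x < A (Suc k)" if "x \<in> set (take (Suc k) w)" for x
    proof -
      obtain l where "l \<le> k" "x = w ! l"
        using \<open>x \<in> _\<close> by (auto simp: in_set_conv_nth less_Suc_eq_le)
      then have "x \<le> w ! k"
        using assms(1) Suc.prems(1) by (simp add: sorted_nth_mono)
      then show ?thesis
        using False by simp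
    qed
    then show ?thesis
      using Suc.prems(2) by blast
  qed
qed

text \<open>\<open>Y n b r\<close> stands for \<open>r \<tturnstile> y(n) = b\<close>.\<close>

locale dominating_relation =
  fixes Y :: "nat \<Rightarrow> nat \<Rightarrow> dnd \<Rightarrow> bool" and p :: dnd
  assumes persistent: "Y n b r \<Longrightarrow> r' \<le> r \<Longrightarrow> Y n b r'"
    and dominates: "\<exists>r\<le>p. \<exists>N. \<forall>n\<ge>N. \<forall>r'\<le>r. \<forall>b. Y n b r' \<longrightarrow> f n \<le> b"
begin

section \<open>Unbounded stems and the function to be escaped\<close>

definition unb :: "nat list \<Rightarrow> nat \<Rightarrow> bool" where
  "unb t n \<longleftrightarrow> (\<forall>m. \<exists>f. \<forall>r\<le>cond t f. \<forall>b. Y n b r \<longrightarrow> m < b)"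

text \<open>Meaningful only if \<open>t\<close> is not unbounded at \<open>n\<close>.\<close>

definition favoured :: "nat list \<Rightarrow> nat \<Rightarrow> nat" where
  "favoured t n = (SOME m. \<forall>f. \<exists>r\<le>cond t f. \<exists>b\<le>m. Y n b r)"

lemma favoured:
  assumes "\<not> unb t n"
  shows "\<exists>r\<le>cond t f. \<exists>b\<le>favoured t n. Y n b r"
proof -
  have "\<exists>m. \<forall>f. \<exists>r\<le>cond t f. \<exists>b\<le>m. Y n b r"
    using assms unfolding unb_def by (meson not_le)
  from someI_ex[OF this] show ?thesis
    unfolding favoured_def by blast
qed

definition bad_ext :: "nat \<Rightarrow> nat list \<Rightarrow> nat \<Rightarrow> nat \<Rightarrow> nat list \<Rightarrow> bool" where
  "bad_ext n t l c u \<longleftrightarrow> sorted (t @ u) \<and> length u = l \<and> (\<forall>x\<in>set u. c \<le> x) \<and> \<not> unb (t @ u) n"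

text \<open>
  The function \<open>h\<close> of the introduction; its representative stems are one bad extension for each
  triple \<open>(t, l, c)\<close> coded below \<open>n\<close>, where a bad one exists.  The lower bound \<open>c\<close> on the new values
  makes up for the side function \<open>f\<^sub>0\<close>, which is only chosen afterwards.
\<close>

definition escape :: "nat \<Rightarrow> nat" where
  "escape n = n + Suc (\<Sum>(t, l, c)\<in>{t :: nat list. to_nat t \<le> n} \<times> {..n} \<times> {..n}.
     favoured (t @ (SOME u. bad_ext n t l c u)) n)"

lemma favoured_less_escape:
  assumes "to_nat t \<le> n" "l \<le> n" "c \<le> n"
  shows "favoured (t @ (SOME u. bad_ext n t l c u)) n < escape n"
proof -
  have "finite (to_nat -` {..n} :: nat list set)"
    by (intro finite_vimageI) auto
  moreover have "to_nat -` {..n} = {t :: nat list. to_nat t \<le> n}"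
    by auto
  ultimately have fin: "finite ({t :: nat list. to_nat t \<le> n} \<times> {..n} \<times> {..n})"
    by simp
  have "(case (t, l, c) of (t, l, c) \<Rightarrow> favoured (t @ (SOME u. bad_ext n t l c u)) n)
      \<le> (\<Sum>(t, l, c)\<in>{t :: nat list. to_nat t \<le> n} \<times> {..n} \<times> {..n}.
          favoured (t @ (SOME u. bad_ext n t l c u)) n)"
    using assms fin by (intro member_le_sum) auto
  then show ?thesis
    by (simp add: escape_def)
qed

end

section \<open>Stems below a condition that forces \<open>escape\<close> to be dominated from
  \<open>N\<close> on\<close>

locale escaping_relation = dominating_relation +
  fixes q :: dnd and N :: nat
  assumes escapes: "\<And>n r b. N \<le> n \<Longrightarrow> r \<le> q \<Longrightarrow> Y n b r \<Longrightarrow> escape n \<le> b"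
begin

abbreviation "t0 \<equiv> stem q"
abbreviation "f0 \<equiv> side q"

text \<open>Describes the stems \<open>t0 @ u\<close> of conditions below \<open>q\<close>, with
  \<open>u\<close> listing the new values.\<close>

definition cone :: "nat list \<Rightarrow> bool" where
  "cone u \<longleftrightarrow> sorted (t0 @ u) \<and> (\<forall>i<length u. f0 (length t0 + i) \<le> u ! i)"

lemma cone_le:
  assumes "cone u"
  shows "cond (t0 @ u) f0 \<le> q"
proof -
  have "f0 i \<le> (t0 @ u) ! i" if i: "length t0 \<le> i" "i < length (t0 @ u)" for i
  proof -
    have "i - length t0 < length u"
      using i by simp
    then have "f0 (length t0 + (i - length t0)) \<le> u ! (i - length t0)"
      using assms unfolding cone_def by blast
    then show ?thesis
      using i by (simp add: nth_append)
  qed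
  moreover have "sorted (t0 @ u)"
    using assms by (simp add: cone_def)
  ultimately show ?thesis
    by (simp add: less_eq_dnd_def)
qed

lemma cone_prefix:
  assumes "cone (u @ v)"
  shows "cone u"
proof -
  have "f0 (length t0 + i) \<le> u ! i" if "i < length u" for i
  proof -
    have "f0 (length t0 + i) \<le> (u @ v) ! i"
      using assms that unfolding cone_def by simp
    then show ?thesis
      using that by (simp add: nth_append)
  qed
  moreover have "sorted (t0 @ u)"
    using assms by (simp add: cone_def sorted_append)
  ultimately show ?thesis
    by (simp add: cone_def)
qed

text \<open>Otherwise the representative \<open>v'\<close> used in \<open>escape\<close> is a bad
  extension as well. Its values are at least \<open>c\<close>, hence respect \<open>f0\<close>, so
  \<open>t0 @ u @ v'\<close> is the stem of a condition below \<open>q\<close>. By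
  \<open>favoured\<close>, some extension of that condition gives y(n) a value below
  \<open>escape n\<close>, against \<open>escapes\<close>.\<close>

lemma unb_far:
  assumes u: "cone u" and v: "sorted (t0 @ u @ v)" "length v = l" "\<forall>x\<in>set v. c \<le> x"
    and c: "\<And>i. i < length t0 + length u + l \<Longrightarrow> f0 i \<le> c"
    and n: "N \<le> n" "to_nat (t0 @ u) \<le> n" "l \<le> n" "c \<le> n"
  shows "unb (t0 @ u @ v) n"
proof (rule ccontr)
  assume "\<not> ?thesis"
  then have "bad_ext n (t0 @ u) l c v"
    using v by (simp add: bad_ext_def)
  moreover define v' where "v' = (SOME v. bad_ext n (t0 @ u) l c v)"
  ultimately have v': "bad_ext n (t0 @ u) l c v'"
    by (metis someI)
  have "cone (u @ v')"
    using u v' unfolding cone_def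
  proof (intro conjI allI impI)
    show "sorted (t0 @ u @ v')"
      using v' by (simp add: bad_ext_def)
    fix i assume i: "i < length (u @ v')"
    show "f0 (length t0 + i) \<le> (u @ v') ! i"
    proof (cases "i < length u")
      case True
      then show ?thesis
        using u by (simp add: cone_def nth_append)
    next
      case False
      then have "c \<le> v' ! (i - length u)"
        using v' i by (simp add: bad_ext_def)
      moreover have "f0 (length t0 + i) \<le> c"
        using i v' by (intro c) (simp add: bad_ext_def)
      ultimately show ?thesis
        using False by (simp add: nth_append)
    qed
  qed
  then have le: "cond (t0 @ u @ v') f0 \<le> q"
    by (rule cone_le)
  have "\<not> unb (t0 @ u @ v') n"
    using v' by (simp add: bad_ext_def)
  then obtain r b where "r \<le> cond (t0 @ u @ v') f0" "b \<le> favoured (t0 @ u @ v') n" "Y n b r"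
    using favoured by blast
  moreover have "favoured (t0 @ u @ v') n < escape n"
    using favoured_less_escape[OF n(2-4)] by (simp add: v'_def)
  ultimately show False
    using escapes[OF n(1), of r b] order.trans[OF _ le] by fastforce
qed

lemma unb_extensions:
  "cone u \<Longrightarrow> \<exists>M. \<forall>n\<ge>M. \<forall>v. length v = l \<longrightarrow> cone (u @ v) \<longrightarrow> unb (t0 @ u @ v) n"
proof (induction l arbitrary: u)
  case 0
  define c where "c = (\<Sum>i<length t0 + length u. f0 i)"
  have "f0 i \<le> c" if "i < length t0 + length u" for i
    unfolding c_def using that by (intro member_le_sum) auto
  then have "unb (t0 @ u @ []) n" if "n \<ge> N + to_nat (t0 @ u) + c" for n
    using 0 that by (intro unb_far[where c = c and l = 0]) (auto simp: cone_def)
  then show ?case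
    by auto
next
  case (Suc l)
  \<comment> \<open>A bound for \<open>f0\<close> at all positions of the extended stem; it
    separates the finitely many small first values from the large ones.\<close>
  define c where "c = (\<Sum>i<length t0 + length u + Suc l. f0 i)"
  have c: "f0 i \<le> c" if "i < length t0 + length u + Suc l" for i
    unfolding c_def using that by (intro member_le_sum) auto
  have "\<forall>x. \<exists>M. cone (u @ [x]) \<longrightarrow>
      (\<forall>n\<ge>M. \<forall>v. length v = l \<longrightarrow> cone (u @ x # v) \<longrightarrow> unb (t0 @ u @ x # v) n)"
    using Suc.IH[of "u @ [_]"] by auto
  then obtain M where M: "\<And>x n v. cone (u @ [x]) \<Longrightarrow> n \<ge> M x \<Longrightarrow> length v = l \<Longrightarrow>
      cone (u @ x # v) \<Longrightarrow> unb (t0 @ u @ x # v) n"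
    by metis
  \<comment> \<open>The last sum collects the bounds from the induction hypothesis for the small
    first values; the other summands meet the premises of \<open>unb_far\<close>.\<close>
  define M' where "M' = N + to_nat (t0 @ u) + Suc l + c + (\<Sum>x<c. M x)"
  have "unb (t0 @ u @ v) n" if n: "n \<ge> M'" and v: "length v = Suc l" "cone (u @ v)" for n v
  proof -
    obtain x v' where [simp]: "v = x # v'"
      using v(1) by (cases v) auto
    have cx: "cone (u @ [x])"
      using v(2) cone_prefix[of "u @ [x]" v'] by simp
    show ?thesis
    proof (cases "x < c")
      case True
      then have "M x \<le> (\<Sum>x<c. M x)"
        by (intro member_le_sum) auto
      then show ?thesis
        using n v cx M[of x n v'] by (simp add: M'_def)
    next
      case False
      have "\<forall>y\<in>set v. c \<le> y"
        using v(2) False by (auto simp: cone_def sorted_append)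
      then show ?thesis
        using Suc.prems n v c
        by (intro unb_far[where c = c and l = "Suc l"]) (auto simp: cone_def M'_def)
    qed
  qed
  then show ?case
    by blast
qed

text \<open>Adding the bounds for all lengths up to \<open>k\<close> gives one bound. The extra
  summand \<open>k\<close> ensures later that \<open>z1 n\<close> does not exceed
  \<open>n\<close>.\<close>

lemma unb_uniform:
  obtains M where "\<And>k. k \<le> M k"
    "\<And>k n v. M k \<le> n \<Longrightarrow> length v \<le> k \<Longrightarrow> cone v \<Longrightarrow> unb (t0 @ v) n"
proof -
  have "cone []"
    by (simp add: cone_def)
  from unb_extensions[OF this]
  obtain M where M: "\<And>n v. n \<ge> M (length v) \<Longrightarrow> cone v \<Longrightarrow> unb (t0 @ v) n"
    by simp metis
  define M' where "M' k = k + (\<Sum>l\<le>k. M l)" for k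
  have "unb (t0 @ v) n" if "M' k \<le> n" "length v \<le> k" "cone v" for k n v
  proof -
    have "M (length v) \<le> (\<Sum>l\<le>k. M l)"
      using that(2) by (intro member_le_sum) auto
    then show ?thesis
      using that by (intro M) (auto simp: M'_def)
  qed
  then show thesis
    by (intro that[of M']) (auto simp: M'_def)
qed

text \<open>The side functions are indexed by triples so that they form a countable family, to which
  \<open>countable_family_dominated\<close> applies.\<close>

lemma unb_witness:
  obtains F where
    "\<And>t n m r b. unb t n \<Longrightarrow> r \<le> cond t (F (t, n, m)) \<Longrightarrow> Y n b r \<Longrightarrow> m < b"
proof -
  have "\<forall>x. \<exists>f. case x of (t, n, m) \<Rightarrow> unb t n \<longrightarrow> (\<forall>r\<le>cond t f. \<forall>b. Y n b r \<longrightarrow> m < b)"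
    by (auto simp: unb_def)
  from choice[OF this] obtain F where
    "\<forall>x. case x of (t, n, m) \<Rightarrow> unb t n \<longrightarrow> (\<forall>r\<le>cond t (F x). \<forall>b. Y n b r \<longrightarrow> m < b)"
    by (rule exE)
  then have "unb t n \<longrightarrow> (\<forall>r\<le>cond t (F (t, n, m)). \<forall>b. Y n b r \<longrightarrow> m < b)" for t n m
    by (auto dest: spec[of _ "(t, n, m)"])
  then show thesis
    by (intro that[of F]) blast
qed

end

section \<open>Thresholds and the lower bound for y\<close>

lemma countable_family_dominated:
  fixes F :: "'a::countable \<Rightarrow> nat \<Rightarrow> nat" and f :: "nat \<Rightarrow> nat"
  obtains g C where "\<And>i. f i \<le> g i" "\<And>x i. F x i \<le> max (g i) (C x)"
proof -
  \<comment> \<open>From index \<open>to_nat x\<close> on, \<open>F x i\<close> is a summand of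
    \<open>g i\<close>; the finitely many earlier values are absorbed by \<open>C x\<close>. The
    summand \<open>f i\<close> makes \<open>g\<close> usable as a larger side function.\<close>
  define g where "g i = f i + (\<Sum>c\<le>i. F (from_nat c) i)" for i
  define C where "C x = (\<Sum>i<to_nat x. F x i)" for x
  have "F x i \<le> max (g i) (C x)" for x i
  proof (cases "i < to_nat x")
    case True
    then have "F x i \<le> C x"
      unfolding C_def by (intro member_le_sum) auto
    then show ?thesis
      by simp
  next
    case False
    then have "F (from_nat (to_nat x)) i \<le> (\<Sum>c\<le>i. F (from_nat c) i)"
      by (intro member_le_sum[where f = "\<lambda>c. F (from_nat c) i"]) auto
    then show ?thesis
      by (simp add: g_def)
  qed
  then show thesis
    by (intro that[of g C]) (auto simp: g_def)
qed

text \<open>Each step passes the constants \<open>C u n\<close> of all \<open>u\<close> of length at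
  most \<open>m\<close> that fit below the preceding threshold; there are only finitely many of
  these.\<close>

primrec threshold :: "(nat list \<Rightarrow> nat \<Rightarrow> nat) \<Rightarrow> nat \<Rightarrow> nat \<Rightarrow> nat" where
  "threshold C m 0 = 0"
| "threshold C m (Suc i) = threshold C m i +
     (\<Sum>(u, n)\<in>{u. set u \<subseteq> {..<threshold C m i} \<and> length u \<le> m} \<times> {..m}. C u n)"

lemma threshold_mono: "i \<le> j \<Longrightarrow> threshold C m i \<le> threshold C m j"
  by (rule lift_Suc_mono_le[of "threshold C m"]) auto

lemma le_threshold:
  assumes "\<forall>x\<in>set u. x < threshold C m i" "length u \<le> m" "n \<le> m"
  shows "C u n \<le> threshold C m (Suc i)"
proof -
  have "(case (u, n) of (u, n) \<Rightarrow> C u n)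
      \<le> (\<Sum>(u, n)\<in>{u. set u \<subseteq> {..<threshold C m i} \<and> length u \<le> m} \<times> {..m}. C u n)"
    using assms by (intro member_le_sum) (auto intro!: finite_cartesian_product finite_lists_length_le)
  then show ?thesis
    by simp
qed

lemma (in escaping_relation) bounded_below_escaping:
  "\<exists>q'\<le>q. \<exists>z0\<in>nondec_unbounded. \<exists>z1\<in>nondec_unbounded. \<exists>K. \<forall>n\<ge>K. \<forall>r\<le>q'. \<forall>b.
     z1 n < length (stem r) \<longrightarrow> Y n b r \<longrightarrow> z0 (stem r ! z1 n) \<le> b"
proof -
  obtain M where kM: "\<And>k. k \<le> M k"
    and M: "\<And>k n v. M k \<le> n \<Longrightarrow> length v \<le> k \<Longrightarrow> cone v \<Longrightarrow> unb (t0 @ v) n"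
    using unb_uniform by blast
  obtain F where F: "\<And>t n m r b. unb t n \<Longrightarrow> r \<le> cond t (F (t, n, m)) \<Longrightarrow> Y n b r \<Longrightarrow> m < b"
    using unb_witness by blast
  obtain f1 C where f1: "\<And>i. f0 i \<le> f1 i" and C: "\<And>x i. F x i \<le> max (f1 i) (C x)"
    using countable_family_dominated[of f0 F] by blast
  define A where "A m = threshold (\<lambda>u n. C (t0 @ u, n, m)) m" for m
  \<comment> \<open>A nonzero value \<open>m\<close> of \<open>z0\<close> at \<open>v\<close>
    certifies that \<open>v\<close> has reached the threshold \<open>A m (Suc m)\<close>.\<close>
  obtain z0 where z0: "z0 \<in> nondec_unbounded" "\<And>v. z0 v = 0 \<or> A (z0 v) (Suc (z0 v)) \<le> v"
    using slow_inverse[of "\<lambda>m. A m (Suc m)"] by blast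
  obtain z1 where z1: "z1 \<in> nondec_unbounded" "\<And>n. z1 n = 0 \<or> M (z1 n) \<le> n"
    using slow_inverse[of M] by blast
  have "\<forall>\<^sub>F n in sequentially. length t0 \<le> z1 n"
    using z1(1) by (auto simp: nondec_unbounded_def filterlim_at_top)
  \<comment> \<open>From \<open>K\<close> on, \<open>z1 n\<close> is a position beyond
    \<open>t0\<close>, where the stem of a condition below \<open>q'\<close> obeys
    \<open>f1\<close>.\<close>
  then obtain K where K: "\<And>n. K \<le> n \<Longrightarrow> length t0 \<le> z1 n"
    by (auto simp: eventually_sequentially)
  define q' where "q' = cond t0 f1"
  have "q' \<le> q"
    using f1 by (auto simp: q'_def less_eq_dnd_def)
  have "z0 (stem r ! z1 n) \<le> b"
    \<comment> \<open>\<open>N\<close> is needed for \<open>escapes\<close>; \<open>M 0\<close>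
      gives \<open>M (z1 n) \<le> n\<close> also when \<open>z1 n = 0\<close>.\<close>
    if n: "n \<ge> K + N + M 0" and r: "r \<le> q'" and k: "z1 n < length (stem r)" and Y: "Y n b r" for n r b
  proof (cases "z0 (stem r ! z1 n) \<le> n")
    case True
    moreover have "r \<le> q"
      using r \<open>q' \<le> q\<close> by simp
    ultimately show ?thesis
      using escapes[of n r b] n Y by (simp add: escape_def)
  next
    case False
    define m where "m = z0 (stem r ! z1 n)"
    have m: "n < m" "A m (Suc m) \<le> stem r ! z1 n"
      using False z0(2)[of "stem r ! z1 n"] by (auto simp: m_def)
    obtain w where w: "stem r = t0 @ w"
      using r by (auto simp: q'_def less_eq_dnd_def)
    have f1w: "f1 i \<le> stem r ! i" if "length t0 \<le> i" "i < length (stem r)" for i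
      using r that by (auto simp: q'_def less_eq_dnd_def)
    have sw: "sorted (t0 @ w)"
      using sorted_stem[of r] by (simp add: w)
    have Mz: "M (z1 n) \<le> n"
      using z1(2)[of n] n by auto
    define k where "k = z1 n - length t0"
    have kn: "z1 n = length t0 + k"
      using K[of n] n by (simp add: k_def)
    have kw: "k < length w" "stem r ! z1 n = w ! k"
      using \<open>z1 n < length (stem r)\<close> by (simp_all add: kn w nth_append)
    \<comment> \<open>This follows from \<open>k \<le> z1 n \<le> M (z1 n) \<le> n < m\<close>. It
      leaves enough thresholds for the entries up to \<open>w ! k\<close> and keeps the part below
      the gap within the length bound in \<open>threshold\<close>.\<close>
    have km: "k \<le> m"
      using kM[of "z1 n"] Mz m(1) kn by simp
    have "A m (Suc k) \<le> A m (Suc m)"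
      unfolding A_def using km by (intro threshold_mono) simp
    then have "A m (Suc k) \<le> w ! k"
      using m(2) kw(2) by simp
    then obtain i j where ij: "j \<le> k" "\<forall>x\<in>set (take j w). x < A m i" "A m (Suc i) \<le> w ! j"
      using sorted_gap[of w k "A m"] sw kw(1) by (auto simp: sorted_append)
    define t where "t = t0 @ take j w"
    have st: "stem r = t @ drop j w" "length t = length t0 + j"
      using ij(1) kw(1) by (simp_all add: t_def w)
    have "sorted t"
      using sorted_stem[of r] unfolding st by (simp add: sorted_append)
    have "cone (take j w)"
      unfolding cone_def
    proof (intro conjI allI impI)
      show "sorted (t0 @ take j w)"
        using \<open>sorted t\<close> by (simp add: t_def)
      fix l assume l: "l < length (take j w)"
      then have "f1 (length t0 + l) \<le> stem r ! (length t0 + l)"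
        using f1w[of "length t0 + l"] by (simp add: w)
      then show "f0 (length t0 + l) \<le> take j w ! l"
        using l f1[of "length t0 + l"] by (simp add: w nth_append)
    qed
    then have unb: "unb t n"
      unfolding t_def using ij(1) kn by (intro M[OF Mz]) auto
    define G where "G = F (t, n, m)"
    \<comment> \<open>The side function of \<open>r\<close> may be smaller than \<open>G\<close>, so
      \<open>r\<close> need not lie below \<open>cond t G\<close>. Raising it keeps the stem and
      yields a condition below both.\<close>
    define r' where "r' = cond (stem r) (\<lambda>i. max (side r i) (G i))"
    have "r' \<le> r"
      by (auto simp: r'_def less_eq_dnd_def)
    have "C (t, n, m) \<le> A m (Suc i)"
      unfolding A_def t_def
      using ij(1,2) km m(1) le_threshold[of "take j w" "\<lambda>u n. C (t0 @ u, n, m)" m i n]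
      by (simp add: A_def)
    then have Cw: "C (t, n, m) \<le> w ! j"
      using ij(3) by simp
    have "r' \<le> cond t G"
    proof (rule le_condI)
      show "stem r' = t @ drop j w"
        unfolding r'_def st(1)[symmetric] by simp
      show "G l \<le> side r' l" for l
        by (simp add: r'_def)
      fix l assume l: "length t \<le> l" "l < length (stem r')"
      then have l': "length t0 + j \<le> l" "l < length (stem r)"
        by (simp_all add: r'_def st(2))
      then have "stem r ! (length t0 + j) \<le> stem r ! l"
        by (intro sorted_nth_mono) auto
      then have "C (t, n, m) \<le> stem r ! l"
        using Cw by (simp add: w)
      \<comment> \<open>\<open>G l\<close> is at most the maximum of \<open>f1 l\<close> and the
        constant for \<open>(t, n, m)\<close>. The stem exceeds the former because \<open>r\<close>
        is below \<open>q'\<close>, the latter because position \<open>l\<close> is beyond the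
        gap.\<close>
      then have "G l \<le> stem r ! l"
        using C[of "(t, n, m)" l] f1w[of l] l' by (simp add: G_def)
      then show "G l \<le> stem r' ! l"
        by (simp add: r'_def)
    qed fact
    then have "m < b"
      using F[OF unb, of r' m b] persistent[OF Y \<open>r' \<le> r\<close>] by (simp add: G_def)
    then show ?thesis
      by (simp add: m_def)
  qed
  then show ?thesis
    using z0(1) z1(1) \<open>q' \<le> q\<close> by blast
qed

lemma (in dominating_relation) bounded_below:
  "\<exists>q\<le>p. \<exists>z0\<in>nondec_unbounded. \<exists>z1\<in>nondec_unbounded. \<exists>K. \<forall>n\<ge>K. \<forall>r\<le>q. \<forall>b.
     z1 n < length (stem r) \<longrightarrow> Y n b r \<longrightarrow> z0 (stem r ! z1 n) \<le> b"
proof -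
  \<comment> \<open>Domination is applied to the single function \<open>escape\<close>, which
    supplies the parameters of \<open>escaping_relation\<close>.\<close>
  obtain q N where "q \<le> p" and *: "\<And>n r b. N \<le> n \<Longrightarrow> r \<le> q \<Longrightarrow> Y n b r \<Longrightarrow> escape n \<le> b"
    using dominates[of escape] by blast
  interpret escaping_relation Y p q N
    by unfold_locales (rule *)
  from bounded_below_escaping obtain q' where "q' \<le> q" and q': "\<exists>z0\<in>nondec_unbounded.
      \<exists>z1\<in>nondec_unbounded. \<exists>K. \<forall>n\<ge>K. \<forall>r\<le>q'. \<forall>b.
        z1 n < length (stem r) \<longrightarrow> Y n b r \<longrightarrow> z0 (stem r ! z1 n) \<le> b"
    by (elim exE conjE)
  have "q' \<le> p"
    using \<open>q' \<le> q\<close> \<open>q \<le> p\<close> by (rule order.trans)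
  then show ?thesis
    by (intro exI[of _ q'] conjI q')
qed

section \<open>The forcing relation\<close>

lemma feq_mono: "(\<sigma> \<^bold>= \<tau>) p \<Longrightarrow> q \<le> p \<Longrightarrow> (\<sigma> \<^bold>= \<tau>) q"
  unfolding feq_iff[of \<sigma> \<tau>] by (blast intro: order.trans)

lemma fmem_mono: "(\<sigma> \<^bold>\<in> \<tau>) p \<Longrightarrow> q \<le> p \<Longrightarrow> (\<sigma> \<^bold>\<in> \<tau>) q"
  unfolding fmem_def by (blast intro: order.trans)

text \<open>Reflexivity is a premise because the rule serves inside the inductive proof of
  \<open>feq_refl\<close>.\<close>

lemma fmemI: "(\<sigma>, s) \<in> pairs \<tau> \<Longrightarrow> p \<le> s \<Longrightarrow> (\<And>q. (\<sigma> \<^bold>= \<sigma>) q) \<Longrightarrow> (\<sigma> \<^bold>\<in> \<tau>) p"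
  unfolding fmem_def by (blast intro: order.trans)

lemma fmemE:
  assumes "(\<sigma> \<^bold>\<in> \<tau>) p"
  obtains r \<pi> s where "r \<le> p" "(\<pi>, s) \<in> pairs \<tau>" "r \<le> s" "(\<sigma> \<^bold>= \<pi>) r"
  using assms unfolding fmem_def by blast

lemma feq_refl: "(\<sigma> \<^bold>= \<sigma>) p"
proof (induction \<sigma> arbitrary: p rule: wf_induct_rule[OF wf_pairs])
  case (1 \<sigma>)
  then have "(\<pi> \<^bold>\<in> \<sigma>) q" if "(\<pi>, s) \<in> pairs \<sigma>" "q \<le> s" for \<pi> s q
    using that by (blast intro: fmemI)
  then show ?case
    unfolding feq_iff[of \<sigma> \<sigma>] by blast
qed

lemma feq_trans: "(\<sigma> \<^bold>= \<tau>) p \<Longrightarrow> (\<tau> \<^bold>= \<upsilon>) p \<Longrightarrow> (\<sigma> \<^bold>= \<upsilon>) p"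
proof (induction \<sigma> arbitrary: \<tau> \<upsilon> p rule: wf_induct_rule[OF wf_pairs])
  case (1 \<sigma>)
  \<comment> \<open>Induction on \<sigma> alone is enough: in both inclusions the hypothesis is
    applied to a member of \<sigma>, the other two names being arbitrary.\<close>
  have IH: "(\<pi> \<^bold>= \<upsilon>) r" if "(\<pi>, s) \<in> pairs \<sigma>" "(\<pi> \<^bold>= \<tau>) r" "(\<tau> \<^bold>= \<upsilon>) r" for \<pi> s \<tau> \<upsilon> r
    using 1(1)[of \<pi>] that by blast
  show ?case
    unfolding feq.simps[of \<sigma> \<upsilon>]
  proof (intro conjI ballI allI impI; clarify)
    fix \<pi> s q assume \<pi>: "(\<pi>, s) \<in> pairs \<sigma>" and q: "q \<le> p" "q \<le> s"
    then obtain r \<pi>' s' where r: "r \<le> q" "(\<pi>', s') \<in> pairs \<tau>" "r \<le> s'" "(\<pi> \<^bold>= \<pi>') r"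
      using 1(2) unfolding feq.simps[of \<sigma> \<tau>] by blast
    moreover have "r \<le> p"
      using r(1) q(1) by (rule order.trans)
    ultimately obtain r' \<pi>'' s'' where r': "r' \<le> r" "(\<pi>'', s'') \<in> pairs \<upsilon>" "r' \<le> s''" "(\<pi>' \<^bold>= \<pi>'') r'"
      using 1(3) unfolding feq.simps[of \<tau> \<upsilon>] by blast
    have "(\<pi> \<^bold>= \<pi>'') r'"
      using \<pi> feq_mono[OF r(4) r'(1)] r'(4) by (rule IH)
    then show "\<exists>r\<le>q. \<exists>(\<pi>', s')\<in>pairs \<upsilon>. r \<le> s' \<and> (\<pi> \<^bold>= \<pi>') r"
      using r' order.trans[OF r'(1) r(1)] by blast
  next
    fix \<pi>'' s'' q assume \<pi>: "(\<pi>'', s'') \<in> pairs \<upsilon>" and q: "q \<le> p" "q \<le> s''"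
    then obtain r \<pi>' s' where r: "r \<le> q" "(\<pi>', s') \<in> pairs \<tau>" "r \<le> s'" "(\<pi>' \<^bold>= \<pi>'') r"
      using 1(3) unfolding feq.simps[of \<tau> \<upsilon>] by blast
    moreover have "r \<le> p"
      using r(1) q(1) by (rule order.trans)
    ultimately obtain r' \<pi> s where r': "r' \<le> r" "(\<pi>, s) \<in> pairs \<sigma>" "r' \<le> s" "(\<pi> \<^bold>= \<pi>') r'"
      using 1(2) unfolding feq.simps[of \<sigma> \<tau>] by blast
    have "(\<pi> \<^bold>= \<pi>'') r'"
      using r'(2,4) feq_mono[OF r(4) r'(1)] by (rule IH)
    then show "\<exists>r\<le>q. \<exists>(\<pi>, s)\<in>pairs \<sigma>. r \<le> s \<and> (\<pi> \<^bold>= \<pi>'') r"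
      using r' order.trans[OF r'(1) r(1)] by blast
  qed
qed

lemma fmem_cong_left:
  assumes "(\<sigma> \<^bold>= \<sigma>') p" "(\<sigma> \<^bold>\<in> \<tau>) p"
  shows "(\<sigma>' \<^bold>\<in> \<tau>) p"
  unfolding fmem_def
proof (intro allI impI)
  fix q assume q: "q \<le> p"
  obtain r \<pi> s where r: "r \<le> q" "(\<pi>, s) \<in> pairs \<tau>" "r \<le> s" "(\<sigma> \<^bold>= \<pi>) r"
    using fmem_mono[OF assms(2) q] by (rule fmemE)
  have "(\<sigma>' \<^bold>= \<sigma>) r"
    using feq_mono[OF assms(1) order.trans[OF r(1) q]] by (simp add: feq_sym)
  then have "(\<sigma>' \<^bold>= \<pi>) r"
    using r(4) by (rule feq_trans)
  then show "\<exists>r\<le>q. \<exists>(\<pi>, s)\<in>pairs \<tau>. r \<le> s \<and> (\<sigma>' \<^bold>= \<pi>) r"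
    using r by blast
qed

lemma fmem_cong_right:
  assumes "(\<tau> \<^bold>= \<tau>') p" "(\<sigma> \<^bold>\<in> \<tau>) p"
  shows "(\<sigma> \<^bold>\<in> \<tau>') p"
  unfolding fmem_def
proof (intro allI impI)
  fix q assume q: "q \<le> p"
  obtain r \<pi> s where r: "r \<le> q" "(\<pi>, s) \<in> pairs \<tau>" "r \<le> s" "(\<sigma> \<^bold>= \<pi>) r"
    using fmem_mono[OF assms(2) q] by (rule fmemE)
  have "(\<tau> \<^bold>= \<tau>') r"
    using feq_mono[OF assms(1) order.trans[OF r(1) q]] .
  then have "(\<pi> \<^bold>\<in> \<tau>') r"
    using r(2,3) unfolding feq_iff[of \<tau> \<tau>'] by blast
  then have "(\<sigma> \<^bold>\<in> \<tau>') r"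
    using r(4) fmem_cong_left[of \<pi> \<sigma>] feq_sym[of \<sigma> \<pi>] by blast
  then show "\<exists>r\<le>q. \<exists>(\<pi>, s)\<in>pairs \<tau>'. r \<le> s \<and> (\<sigma> \<^bold>= \<pi>) r"
    using r(1) unfolding fmem_def by (blast intro: order.trans)
qed

text \<open>No closure of \<psi> under density is assumed, so the double negation yields \<psi> only
  at stronger conditions; this is why later arguments keep passing to extensions.\<close>

lemma fimp_iff: "(\<phi> \<^bold>\<longrightarrow> \<psi>) p \<longleftrightarrow> (\<forall>q\<le>p. \<phi> q \<longrightarrow> (\<exists>r\<le>q. \<psi> r))"
  by (simp add: fimp_def fnot_def fconj_def)

lemma fdisj_iff: "(\<phi> \<^bold>\<or> \<psi>) p \<longleftrightarrow> (\<forall>q\<le>p. \<exists>r\<le>q. \<phi> r \<or> \<psi> r)"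
  by (auto simp: fdisj_def fnot_def fconj_def)

lemma fball_iff: "(\<^bold>\<forall>x\<^bold>\<in>\<tau>. \<phi> x) p \<longleftrightarrow> (\<forall>x. \<forall>q\<le>p. (x \<^bold>\<in> \<tau>) q \<longrightarrow> (\<exists>r\<le>q. \<phi> x r))"
  by (simp add: fball_def fall_def fimp_iff)

lemma fbex_iff: "(\<^bold>\<exists>x\<^bold>\<in>\<tau>. \<phi> x) p \<longleftrightarrow> (\<forall>q\<le>p. \<exists>r\<le>q. \<exists>x. (x \<^bold>\<in> \<tau>) r \<and> \<phi> x r)"
  by (simp add: fbex_def fex_def fall_def fnot_def fconj_def) blast

lemma fbexI: "(\<And>q. q \<le> p \<Longrightarrow> (x \<^bold>\<in> \<tau>) q \<and> \<phi> x q) \<Longrightarrow> (\<^bold>\<exists>x\<^bold>\<in>\<tau>. \<phi> x) p"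
  unfolding fbex_iff by blast

lemma fbexE:
  assumes "(\<^bold>\<exists>x\<^bold>\<in>\<tau>. \<phi> x) p"
  obtains r x where "r \<le> p" "(x \<^bold>\<in> \<tau>) r" "\<phi> x r"
  using assms unfolding fbex_iff by blast

lemma fballI: "(\<And>x q. q \<le> p \<Longrightarrow> (x \<^bold>\<in> \<tau>) q \<Longrightarrow> \<phi> x q) \<Longrightarrow> (\<^bold>\<forall>x\<^bold>\<in>\<tau>. \<phi> x) p"
  unfolding fball_iff by blast

lemma fballE:
  assumes "(\<^bold>\<forall>x\<^bold>\<in>\<tau>. \<phi> x) p" "q \<le> p" "(x \<^bold>\<in> \<tau>) q"
  obtains r where "r \<le> q" "\<phi> x r"
  using assms unfolding fball_iff by blast

lemma fimpI: "(\<And>q. q \<le> p \<Longrightarrow> \<phi> q \<Longrightarrow> \<exists>r\<le>q. \<psi> r) \<Longrightarrow> (\<phi> \<^bold>\<longrightarrow> \<psi>) p"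
  unfolding fimp_iff by blast

lemma fimpE:
  assumes "(\<phi> \<^bold>\<longrightarrow> \<psi>) p" "\<phi> p"
  obtains r where "r \<le> p" "\<psi> r"
  using assms unfolding fimp_iff by blast

section \<open>Natural numbers and reals\<close>

lemma pairs_check_nat: "pairs (check_nat n :: 'i dnd_name) = (\<lambda>k. (check_nat k, top)) ` {..<n}"
proof (induction n)
  case 0
  show ?case
    by (simp add: pairs_mk_name_countable)
next
  case (Suc n)
  have "countable (insert (check_nat n, top) (pairs (check_nat n :: 'i dnd_name)))"
    unfolding Suc by (intro countable_insert countable_image) simp
  then have "pairs (check_nat (Suc n) :: 'i dnd_name) = insert (check_nat n, top) (pairs (check_nat n))"
    by (simp add: pairs_mk_name_countable)
  then show ?case
    by (simp add: Suc lessThan_Suc)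
qed

lemma pairs_omega: "pairs (\<^bold>\<omega> :: 'i dnd_name) = range (\<lambda>n. (check_nat n, top))"
  unfolding omega_def by (rule pairs_mk_name_countable) simp

lemma pairs_upair: "pairs (upair \<sigma> \<tau> :: 'i dnd_name) = {(\<sigma>, top), (\<tau>, top)}"
  unfolding upair_def by (rule pairs_mk_name_countable) simp

lemma pairs_check_real:
  "pairs (check_real f :: 'i dnd_name) = range (\<lambda>n. (opair (check_nat n) (check_nat (f n)), top))"
  unfolding check_real_def by (rule pairs_mk_name_countable) simp

lemma fmem_omega: "(check_nat n \<^bold>\<in> (\<^bold>\<omega> :: 'i dnd_name)) p"
  by (rule fmemI[of _ top]) (auto simp: pairs_omega feq_refl)

lemma fmem_omegaE:
  assumes "(\<sigma> \<^bold>\<in> (\<^bold>\<omega> :: 'i dnd_name)) p"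
  obtains r n where "r \<le> p" "(\<sigma> \<^bold>= check_nat n) r"
  using assms by (rule fmemE) (auto simp: pairs_omega intro: that)

lemma fmem_check_reals: "f \<in> A \<Longrightarrow> (check_real f \<^bold>\<in> (check_reals A :: 'i dnd_name)) p"
  by (rule fmemI[of _ top]) (auto simp: pairs_check_reals feq_refl)

text \<open>If \<open>n < m\<close>, then \<open>check_nat n\<close> is forced into itself, so some
  condition makes it equal to \<open>check_nat k\<close> with \<open>k < n\<close>; the induction
  hypothesis at \<open>n\<close> gives \<open>n \<le> k\<close>.\<close>

lemma feq_check_nat_le:
  "(check_nat m \<^bold>= (check_nat n :: 'i dnd_name)) p \<Longrightarrow> m \<le> n"
proof (induction m arbitrary: n p rule: less_induct)
  case (less m)
  show ?case
  proof (rule ccontr)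
    assume "\<not> m \<le> n"
    then have "(check_nat n :: 'i dnd_name, top) \<in> pairs (check_nat m)"
      by (auto simp: pairs_check_nat)
    then have "(check_nat n \<^bold>\<in> (check_nat n :: 'i dnd_name)) p"
      using less.prems unfolding feq_iff by (auto dest: bspec[of _ _ "(check_nat n, top)"])
    then obtain r k where "k < n" "(check_nat n \<^bold>= (check_nat k :: 'i dnd_name)) r"
      by (rule fmemE) (auto simp: pairs_check_nat)
    then show False
      using less.IH[of n k r] \<open>\<not> m \<le> n\<close> by simp
  qed
qed

lemma feq_check_natD: "(check_nat m \<^bold>= (check_nat n :: 'i dnd_name)) p \<Longrightarrow> m = n"
  using feq_check_nat_le feq_sym by (metis order.antisym)

lemma fmem_check_natI: "m < n \<Longrightarrow> (check_nat m \<^bold>\<in> (check_nat n :: 'i dnd_name)) p"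
  by (rule fmemI[of _ top]) (auto simp: pairs_check_nat feq_refl)

lemma fmem_check_natD:
  assumes "(check_nat m \<^bold>\<in> (check_nat n :: 'i dnd_name)) p"
  shows "m < n"
  using assms by (rule fmemE) (auto simp: pairs_check_nat dest: feq_check_natD)

lemma nat_le_check_natI:
  assumes "m \<le> n" "(\<sigma> \<^bold>= (check_nat m :: 'i dnd_name)) p" "(\<tau> \<^bold>= check_nat n) p"
  shows "(\<sigma> \<^bold>\<le> \<tau>) p"
  unfolding nat_le_def fdisj_iff
proof (intro allI impI)
  fix q assume "q \<le> p"
  then have \<sigma>: "(check_nat m \<^bold>= \<sigma>) q" and \<tau>: "(check_nat n \<^bold>= \<tau>) q"
    using assms(2,3) feq_mono feq_sym by blast+
  show "\<exists>r\<le>q. (\<sigma> \<^bold>\<in> \<tau>) r \<or> (\<sigma> \<^bold>= \<tau>) r"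
  proof (cases "m = n")
    case True
    then have "(\<sigma> \<^bold>= \<tau>) q"
      using \<sigma> \<tau> feq_sym feq_trans by blast
    then show ?thesis
      by blast
  next
    case False
    then have "(check_nat m \<^bold>\<in> (check_nat n :: 'i dnd_name)) q"
      using assms(1) by (intro fmem_check_natI) simp
    then have "(\<sigma> \<^bold>\<in> \<tau>) q"
      using fmem_cong_left[OF \<sigma>] fmem_cong_right[OF \<tau>] by blast
    then show ?thesis
      by blast
  qed
qed

lemma nat_le_check_natD:
  assumes "(\<sigma> \<^bold>\<le> \<tau>) p" "(\<sigma> \<^bold>= (check_nat m :: 'i dnd_name)) p" "(\<tau> \<^bold>= check_nat n) p"
  shows "m \<le> n"
proof -
  obtain r where r: "r \<le> p" "(\<sigma> \<^bold>\<in> \<tau>) r \<or> (\<sigma> \<^bold>= \<tau>) r"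
    using assms(1) unfolding nat_le_def fdisj_iff by blast
  note eq = feq_mono[OF assms(2) r(1)] feq_mono[OF assms(3) r(1)]
  from r(2) show ?thesis
  proof
    assume "(\<sigma> \<^bold>\<in> \<tau>) r"
    then have "(check_nat m \<^bold>\<in> (check_nat n :: 'i dnd_name)) r"
      using eq by (blast intro: fmem_cong_left fmem_cong_right)
    then show ?thesis
      by (auto dest: fmem_check_natD)
  next
    assume "(\<sigma> \<^bold>= \<tau>) r"
    then have "(check_nat m \<^bold>= (check_nat n :: 'i dnd_name)) r"
      using eq feq_sym feq_trans by blast
    then show ?thesis
      by (auto dest: feq_check_natD)
  qed
qed

lemma upair_cong:
  assumes "(\<sigma> \<^bold>= (\<sigma>' :: 'i dnd_name)) p" "(\<tau> \<^bold>= \<tau>') p"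
  shows "(upair \<sigma> \<tau> \<^bold>= upair \<sigma>' \<tau>') p"
  using assms unfolding feq.simps[of "upair \<sigma> \<tau>"] pairs_upair
  by (auto intro: feq_mono)

lemma opair_cong:
  assumes "(\<sigma> \<^bold>= (\<sigma>' :: 'i dnd_name)) p" "(\<tau> \<^bold>= \<tau>') p"
  shows "(opair \<sigma> \<tau> \<^bold>= opair \<sigma>' \<tau>') p"
  unfolding opair_def using assms by (intro upair_cong)

text \<open>Which component is equal to \<pi> is decided only by an extension. For numerals this
  loses nothing, since equality forced by any condition is true equality.\<close>

lemma upair_leftD:
  assumes "(upair \<sigma> \<tau> \<^bold>= (upair \<sigma>' \<tau>' :: 'i dnd_name)) p" "\<pi> \<in> {\<sigma>, \<tau>}"
  shows "\<exists>r\<le>p. \<exists>\<pi>'\<in>{\<sigma>', \<tau>'}. (\<pi> \<^bold>= \<pi>') r"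
proof -
  have "(\<pi> \<^bold>\<in> upair \<sigma>' \<tau>') p"
    using assms unfolding feq_iff pairs_upair by auto
  then show ?thesis
    by (rule fmemE) (auto simp: pairs_upair)
qed

lemma upair_rightD:
  assumes "(upair \<sigma> \<tau> \<^bold>= (upair \<sigma>' \<tau>' :: 'i dnd_name)) p" "\<pi>' \<in> {\<sigma>', \<tau>'}"
  shows "\<exists>r\<le>p. \<exists>\<pi>\<in>{\<sigma>, \<tau>}. (\<pi> \<^bold>= \<pi>') r"
  using upair_leftD[of \<sigma>' \<tau>' \<sigma> \<tau> p \<pi>'] assms by (simp add: feq_sym)

lemma upair_check_natD:
  assumes "(upair (check_nat a) (check_nat b) \<^bold>= (upair (check_nat c) (check_nat d) :: 'i dnd_name)) p"
  shows "{a, b} = {c, d}"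
proof -
  have "a \<in> {c, d}" "b \<in> {c, d}"
    using upair_leftD[OF assms, of "check_nat a"] upair_leftD[OF assms, of "check_nat b"]
    by (auto dest: feq_check_natD)
  moreover have "c \<in> {a, b}" "d \<in> {a, b}"
    using upair_rightD[OF assms, of "check_nat c"] upair_rightD[OF assms, of "check_nat d"]
    by (auto dest: feq_check_natD)
  ultimately show ?thesis
    by blast
qed

lemma opair_check_natD:
  assumes "(opair (check_nat a) (check_nat b) \<^bold>= (opair (check_nat c) (check_nat d) :: 'i dnd_name)) p"
  shows "a = c" "b = d"
proof -
  let ?u = "\<lambda>a b. upair (check_nat a) (check_nat b) :: 'i dnd_name"
  note eq = assms[unfolded opair_def]
  have "{a} \<in> {{c}, {c, d}}" "{a, b} \<in> {{c}, {c, d}}"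
    using upair_leftD[OF eq, of "?u a a"] upair_leftD[OF eq, of "?u a b"]
    by (auto dest!: upair_check_natD)
  moreover have "{c} \<in> {{a}, {a, b}}" "{c, d} \<in> {{a}, {a, b}}"
    using upair_rightD[OF eq, of "?u c c"] upair_rightD[OF eq, of "?u c d"]
    by (auto dest!: upair_check_natD)
  ultimately show "a = c" "b = d"
    by (auto simp: doubleton_eq_iff)
qed

lemma graph_cong:
  assumes "(\<sigma> \<^bold>= (\<sigma>' :: 'i dnd_name)) p" "(\<tau> \<^bold>= \<tau>') p" "graph x \<sigma> \<tau> p"
  shows "graph x \<sigma>' \<tau>' p"
  using assms unfolding graph_def by (blast intro: fmem_cong_left opair_cong)

lemma graph_mono: "graph x \<sigma> \<tau> p \<Longrightarrow> q \<le> p \<Longrightarrow> graph x \<sigma> \<tau> q"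
  unfolding graph_def by (rule fmem_mono)

lemma graph_check_realI: "graph (check_real f :: 'i dnd_name) (check_nat n) (check_nat (f n)) p"
  unfolding graph_def by (rule fmemI[of _ top]) (auto simp: pairs_check_real feq_refl)

lemma graph_check_realD:
  assumes "graph (check_real f :: 'i dnd_name) (check_nat n) (check_nat m) p"
  shows "m = f n"
  using assms unfolding graph_def
  by (rule fmemE) (auto simp: pairs_check_real dest: opair_check_natD)

text \<open>Membership in the name is witnessed, at some extension, by a condition \<open>s\<close>
  that contributes the pair; stems of conditions below \<open>s\<close> extend that of
  \<open>s\<close>.\<close>

lemma graph_generic_realD:
  assumes "graph (\<^bold>d :: 'i dnd_name) (check_nat n) (check_nat m) p"
  obtains r where "r \<le> p" "n < length (stem r)" "stem r ! n = m"
  using assms unfolding graph_def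
proof (rule fmemE)
  fix r \<pi> s
  assume r: "r \<le> p" "(\<pi>, s) \<in> pairs (\<^bold>d :: 'i dnd_name)" "r \<le> s"
    and eq: "(opair (check_nat n) (check_nat m) \<^bold>= \<pi>) r"
  then obtain i where i: "\<pi> = opair (check_nat i) (check_nat (stem s ! i))" "i < length (stem s)"
    by (auto simp: pairs_generic_real)
  then have "n = i" "m = stem s ! i"
    using opair_check_natD[OF eq[unfolded i(1)]] by auto
  moreover obtain t where "stem r = stem s @ t"
    using r(3) by (auto simp: less_eq_dnd_def)
  ultimately show thesis
    using r(1) i(2) by (intro that[of r]) (auto simp: nth_append)
qed

section \<open>Passing between forced statements and the combinatorial ones\<close>

lemma dominatingD:
  assumes "dominating (y :: 'i dnd_name) p"
  shows "\<exists>r\<le>p. \<exists>N. \<forall>n\<ge>N. \<forall>r'\<le>r. \<forall>b. graph y (check_nat n) (check_nat b) r' \<longrightarrow> f n \<le> b"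
proof -
  obtain r1 where r1: "r1 \<le> p" "(graph (check_real f) \<^bold>\<le>\<^sup>* graph y) r1"
    using assms[unfolded dominating_def] order.refl fmem_check_reals[OF UNIV_I] by (rule fballE)
  obtain r2 k where r2: "r2 \<le> r1" "(k \<^bold>\<in> \<^bold>\<omega>) r2" and
    k: "(\<^bold>\<forall>n\<^bold>\<in>\<^bold>\<omega>. k \<^bold>\<le> n \<^bold>\<longrightarrow> (\<^bold>\<forall>a\<^bold>\<in>\<^bold>\<omega>. \<^bold>\<forall>b\<^bold>\<in>\<^bold>\<omega>.
          graph (check_real f) n a \<^bold>\<and> graph y n b \<^bold>\<longrightarrow> a \<^bold>\<le> b)) r2"
    using r1(2) unfolding le_star_def by (rule fbexE)
  \<comment> \<open>Deciding the name \<open>k\<close> as a numeral turns it into an actual starting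
    point \<open>N\<close>, valid for all conditions below \<open>r\<close>.\<close>
  obtain r N where r: "r \<le> r2" "(k \<^bold>= check_nat N) r"
    using r2(2) by (rule fmem_omegaE)
  have "f n \<le> b" if n: "n \<ge> N" and q: "q \<le> r" and y: "graph y (check_nat n) (check_nat b) q" for n q b
  proof -
    obtain q1 where q1: "q1 \<le> q" "(k \<^bold>\<le> check_nat n \<^bold>\<longrightarrow> (\<^bold>\<forall>a\<^bold>\<in>\<^bold>\<omega>. \<^bold>\<forall>b\<^bold>\<in>\<^bold>\<omega>.
        graph (check_real f) (check_nat n) a \<^bold>\<and> graph y (check_nat n) b \<^bold>\<longrightarrow> a \<^bold>\<le> b)) q1"
      using k order.trans[OF q r(1)] fmem_omega by (rule fballE)
    have "(k \<^bold>\<le> check_nat n) q1"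
      using n feq_mono[OF r(2) order.trans[OF q1(1) q]] feq_refl by (rule nat_le_check_natI)
    with q1(2) obtain q2 where q2: "q2 \<le> q1" "(\<^bold>\<forall>a\<^bold>\<in>\<^bold>\<omega>. \<^bold>\<forall>b\<^bold>\<in>\<^bold>\<omega>.
        graph (check_real f) (check_nat n) a \<^bold>\<and> graph y (check_nat n) b \<^bold>\<longrightarrow> a \<^bold>\<le> b) q2"
      by (rule fimpE)
    obtain q3 where q3: "q3 \<le> q2" "(\<^bold>\<forall>b\<^bold>\<in>\<^bold>\<omega>.
        graph (check_real f :: 'i dnd_name) (check_nat n) (check_nat (f n)) \<^bold>\<and> graph y (check_nat n) b \<^bold>\<longrightarrow>
        check_nat (f n) \<^bold>\<le> b) q3"
      using q2(2) order.refl fmem_omega[of "f n"] by (rule fballE)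
    obtain q4 where q4: "q4 \<le> q3"
      "(graph (check_real f :: 'i dnd_name) (check_nat n) (check_nat (f n)) \<^bold>\<and> graph y (check_nat n) (check_nat b) \<^bold>\<longrightarrow>
        (check_nat (f n) :: 'i dnd_name) \<^bold>\<le> check_nat b) q4"
      using q3(2) order.refl fmem_omega[of b] by (rule fballE)
    have "q4 \<le> q"
      using q1(1) q2(1) q3(1) q4(1) by order
    then have "(graph (check_real f :: 'i dnd_name) (check_nat n) (check_nat (f n)) \<^bold>\<and>
        graph y (check_nat n) (check_nat b)) q4"
      unfolding fconj_def by (intro conjI graph_check_realI graph_mono[OF y])
    \<comment> \<open>The goal compares ground-model numbers, so a single extension that forces the
      inequality is enough.\<close>
    with q4(2) obtain q5 where "(check_nat (f n) \<^bold>\<le> (check_nat b :: 'i dnd_name)) q5"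
      by (rule fimpE)
    then show ?thesis
      by (rule nat_le_check_natD[OF _ feq_refl feq_refl])
  qed
  moreover have "r \<le> p"
    using r(1) r2(1) r1(1) by order
  ultimately show ?thesis
    by blast
qed

lemma generic_comp_le_starI:
  fixes y :: "'i dnd_name"
  assumes "\<And>n r b. K \<le> n \<Longrightarrow> r \<le> p \<Longrightarrow> z1 n < length (stem r) \<Longrightarrow>
      graph y (check_nat n) (check_nat b) r \<Longrightarrow> z0 (stem r ! z1 n) \<le> b"
  shows "(graph (check_real z0) \<^bold>\<circ> graph \<^bold>d \<^bold>\<circ> graph (check_real z1) \<^bold>\<le>\<^sup>* graph y) p"
  unfolding le_star_def
proof (rule fbexI[where x = "check_nat K"], intro conjI fmem_omega fballI fimpI)
  fix p0 q1 q2 and \<nu> :: "'i dnd_name"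
  assume le1: "p0 \<le> p" "q1 \<le> p0" "q2 \<le> q1" and \<nu>: "(\<nu> \<^bold>\<in> \<^bold>\<omega>) q1" and K: "(check_nat K \<^bold>\<le> \<nu>) q2"
  show "\<exists>r\<le>q2. (\<^bold>\<forall>\<alpha>\<^bold>\<in>\<^bold>\<omega>. \<^bold>\<forall>\<beta>\<^bold>\<in>\<^bold>\<omega>.
      (graph (check_real z0) \<^bold>\<circ> graph \<^bold>d \<^bold>\<circ> graph (check_real z1)) \<nu> \<alpha> \<^bold>\<and> graph y \<nu> \<beta> \<^bold>\<longrightarrow> \<alpha> \<^bold>\<le> \<beta>) r"
  proof (rule exI[of _ q2], intro conjI order.refl fballI fimpI)
    fix q3 q4 q5 and \<alpha> \<beta> :: "'i dnd_name"
    assume le: "q3 \<le> q2" "q4 \<le> q3" "q5 \<le> q4"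
      and mem: "(\<alpha> \<^bold>\<in> \<^bold>\<omega>) q3" "(\<beta> \<^bold>\<in> \<^bold>\<omega>) q4"
      and comp: "((graph (check_real z0) \<^bold>\<circ> graph \<^bold>d \<^bold>\<circ> graph (check_real z1)) \<nu> \<alpha> \<^bold>\<and> graph y \<nu> \<beta>) q5"
    show "\<exists>r\<le>q5. (\<alpha> \<^bold>\<le> \<beta>) r"
    proof -
      \<comment> \<open>The composition is opened from the inside: \<kappa> names z1(\<nu>), and
        then \<iota> names d(\<kappa>).\<close>
      obtain r1 \<kappa> where r1: "r1 \<le> q5" "(\<kappa> \<^bold>\<in> \<^bold>\<omega>) r1"
        "(graph (check_real z1) \<nu> \<kappa> \<^bold>\<and> (graph (check_real z0) \<^bold>\<circ> graph \<^bold>d) \<kappa> \<alpha>) r1"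
        using comp[unfolded fconj_def fcomp_def[of "_ \<^bold>\<circ> _"], THEN conjunct1] unfolding fconj_def
        by (rule fbexE)
      obtain r2 \<iota> where r2: "r2 \<le> r1" "(\<iota> \<^bold>\<in> \<^bold>\<omega>) r2" "(graph \<^bold>d \<kappa> \<iota> \<^bold>\<and> graph (check_real z0) \<iota> \<alpha>) r2"
        using r1(3)[unfolded fconj_def fcomp_def, THEN conjunct2] unfolding fconj_def
        by (rule fbexE)
      have le2: "r2 \<le> q1" "r2 \<le> q2" "r2 \<le> q3" "r2 \<le> q4" "r2 \<le> q5" "r2 \<le> p"
        using le1 le r1(1) r2(1) by order+
      obtain r3 n where r3: "r3 \<le> r2" "(\<nu> \<^bold>= check_nat n) r3"
        using fmem_mono[OF \<nu> le2(1)] by (rule fmem_omegaE)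
      obtain r4 k where r4: "r4 \<le> r3" "(\<kappa> \<^bold>= check_nat k) r4"
        using fmem_mono[OF r1(2) order.trans[OF r3(1) r2(1)]] by (rule fmem_omegaE)
      have "r4 \<le> r2" "r4 \<le> q3" "r4 \<le> q4"
        using r3(1) r4(1) le2 by order+
      obtain r5 i where r5: "r5 \<le> r4" "(\<iota> \<^bold>= check_nat i) r5"
        using fmem_mono[OF r2(2) \<open>r4 \<le> r2\<close>] by (rule fmem_omegaE)
      obtain r6 a where r6: "r6 \<le> r5" "(\<alpha> \<^bold>= check_nat a) r6"
        using fmem_mono[OF mem(1) order.trans[OF r5(1) \<open>r4 \<le> q3\<close>]] by (rule fmem_omegaE)
      have "r6 \<le> q4"
        using r5(1) r6(1) \<open>r4 \<le> q4\<close> by order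
      obtain r7 b where r7: "r7 \<le> r6" "(\<beta> \<^bold>= check_nat b) r7"
        using fmem_mono[OF mem(2) \<open>r6 \<le> q4\<close>] by (rule fmem_omegaE)
      have le7: "r7 \<le> r1" "r7 \<le> r2" "r7 \<le> r3" "r7 \<le> r4" "r7 \<le> r5" "r7 \<le> q5" "r7 \<le> q2" "r7 \<le> p"
        using r7(1) r6(1) r5(1) r4(1) r3(1) r2(1) r1(1) le2 by order+
      \<comment> \<open>All five names are now decided as numerals by the one condition
        \<open>r7\<close>.\<close>
      note eq = feq_mono[OF r3(2) le7(3)] feq_mono[OF r4(2) le7(4)] feq_mono[OF r5(2) le7(5)]
        feq_mono[OF r6(2) r7(1)] r7(2)
      have "graph (check_real z1) \<nu> \<kappa> r7" "graph \<^bold>d \<kappa> \<iota> r7" "graph (check_real z0) \<iota> \<alpha> r7" "graph y \<nu> \<beta> r7"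
        using r1(3) r2(3) comp le7(1,2,6) by (auto simp: fconj_def intro: graph_mono)
      then have gr: "graph (check_real z1 :: 'i dnd_name) (check_nat n) (check_nat k) r7"
        "graph (\<^bold>d :: 'i dnd_name) (check_nat k) (check_nat i) r7"
        "graph (check_real z0 :: 'i dnd_name) (check_nat i) (check_nat a) r7"
        "graph y (check_nat n) (check_nat b) r7"
        using eq by (blast intro: graph_cong)+
      have "k = z1 n" "a = z0 i"
        using gr(1,3) by (auto dest: graph_check_realD)
      \<comment> \<open>The stem of \<open>r7\<close> may be too short to show the value of d at
        \<open>k\<close>. The extension \<open>r8\<close> serves to derive \<open>a \<le> b\<close>,
        which is then read back at \<open>r7\<close>.\<close>
      moreover obtain r8 where r8: "r8 \<le> r7" "k < length (stem r8)" "stem r8 ! k = i"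
        using gr(2) by (rule graph_generic_realD)
      moreover have "K \<le> n"
      proof (rule nat_le_check_natD)
        show "(check_nat K \<^bold>\<le> \<nu>) r7"
          using K le7(7) unfolding nat_le_def fdisj_iff by (meson order.trans)
      qed (rule feq_refl eq)+
      moreover have "r8 \<le> p"
        using r8(1) le7(8) by order
      ultimately have "a \<le> b"
        using assms[of n r8 b] graph_mono[OF gr(4) r8(1)] by simp
      then have "(\<alpha> \<^bold>\<le> \<beta>) r7"
        using eq(4,5) by (rule nat_le_check_natI)
      then show ?thesis
        using le7(6) by blast
    qed
  qed
qed

theorem theorem3:
  shows "\<tturnstile> (\<^bold>\<forall>y :: 'i dnd_name. is_real y \<^bold>\<and> dominating y \<^bold>\<longrightarrow>
           (\<^bold>\<exists>z0\<^bold>\<in>check_reals nondec_unbounded. \<^bold>\<exists>z1\<^bold>\<in>check_reals nondec_unbounded.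
              graph z0 \<^bold>\<circ> graph \<^bold>d \<^bold>\<circ> graph z1 \<^bold>\<le>\<^sup>* graph y))"
  unfolding forced_def fall_def
proof (intro allI fimpI)
  fix y :: "'i dnd_name" and p
  assume "(is_real y \<^bold>\<and> dominating y) p"
  then have dom: "dominating y p"
    by (simp add: fconj_def)
  interpret dominating_relation "\<lambda>n b. graph y (check_nat n) (check_nat b)" p
    by unfold_locales (fact graph_mono, rule dominatingD[OF dom])
  obtain q z0 z1 K where "q \<le> p" and z: "z0 \<in> nondec_unbounded" "z1 \<in> nondec_unbounded"
    and K: "\<forall>n\<ge>K. \<forall>r\<le>q. \<forall>b. z1 n < length (stem r) \<longrightarrow>
      graph y (check_nat n) (check_nat b) r \<longrightarrow> z0 (stem r ! z1 n) \<le> b"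
    using bounded_below by (elim exE conjE bexE)
  \<comment> \<open>\<open>fbexI\<close> asks for the body at every condition below
    \<open>q\<close>; the bound \<open>K\<close> is inherited by all of them.\<close>
  have "(graph (check_real z0) \<^bold>\<circ> graph \<^bold>d \<^bold>\<circ> graph (check_real z1) \<^bold>\<le>\<^sup>* graph y) r" if "r \<le> q" for r
    using K order.trans[OF _ that] by (intro generic_comp_le_starI[where K = K]) blast
  then have "(\<^bold>\<exists>z0\<^bold>\<in>check_reals nondec_unbounded. \<^bold>\<exists>z1\<^bold>\<in>check_reals nondec_unbounded.
      graph z0 \<^bold>\<circ> graph \<^bold>d \<^bold>\<circ> graph z1 \<^bold>\<le>\<^sup>* graph y) q"
    using z
    by (intro fbexI[where x = "check_real z0"] fbexI[where x = "check_real z1"] conjI fmem_check_reals)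
       (auto intro: order.trans)
  then show "\<exists>q\<le>p. (\<^bold>\<exists>z0\<^bold>\<in>check_reals nondec_unbounded. \<^bold>\<exists>z1\<^bold>\<in>check_reals nondec_unbounded.
      graph z0 \<^bold>\<circ> graph \<^bold>d \<^bold>\<circ> graph z1 \<^bold>\<le>\<^sup>* graph y) q"
    using \<open>q \<le> p\<close> by blast
qed

end
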